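(* Let $f:\mathbb{R}^n\to\mathbb{R}$ be continuously differentiable with locally Lipschitz continuous gradient. Suppose $f$ attains its minimum value $f^\star=f(x^\star)>-\infty$ at a unique minimizer $x^\star\in\mathbb{R}^n$, and suppose there is $\mu>0$ such that $\frac12\|\nabla f(x)\|^2\ge\mu\,(f(x)-f^\star)$ for all $x\in\mathbb{R}^n$. Let $c_1,c_2>0$, $p_1>2$, $p_2\in(1,2)$, and set $$\alpha=\frac{p_1}{2(p_1-1)},\quad \beta=\frac{p_2}{2(p_2-1)},\quad p=c_1(2\mu)^{\alpha},\quad q=c_2(2\mu)^{\beta}.$$ Let $x_0\in\mathbb{R}^n$ and let $x(t)$, $t\ge0$, be the solution with $x(0)=x_0$ of the flow (called FxTS-GF) $$\dot x=\begin{cases}-c_1\dfrac{\nabla f(x)}{\|\nabla f(x)\|^{\frac{p_1-2}{p_1-1}}}-c_2\dfrac{\nabla f(x)}{\|\nabla f(x)\|^{\frac{p_2-2}{p_2-1}}}, & \nabla f(x)\ne 0,\\[2mm] 0, & \nabla f(x)=0.\end{cases}$$ Then the static regret $\mathcal{R}_S(T,x_0)=\int_0^T\big(f(x(t))-f(x^\star)\big)\,dt$ of this flow, for any time $T>0$, is bounded by the constant $l_1+l_2$, with $$l_1=\frac{1}{p(2-\alpha)},\qquad l_2=\frac{\big(1+V(0)^{\beta-1}\big)^{\frac{\beta-2}{\beta-1}}-1}{q\,V(0)^{\beta-2}(\beta-2)},$$ where $V(0)=f(x_0)-f^\star$.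
   Context: $\|\cdot\|$ is the Euclidean norm. Under the stated assumptions the flow has a unique continuous solution defined for all $t\ge0$ for every initial condition (a known fact).
   Formalization: For p_2 = 4/3 (β = 2) the printed l_2 is 0/0; there l_2 is taken to be its limit ln(1+V(0))/q. For V(0) = 0, where the printed l_2 is also undefined, l_2 is taken to be 0. Otherwise l_2 is as printed. *)

theory Defs
  imports "HOL-Analysis.Analysis"
begin

text \<open>The right-hand side of the flow, as a function of the gradient field \<open>g\<close> of the objective.\<close>

definition fxts_gf ::
  "real \<Rightarrow> real \<Rightarrow> real \<Rightarrow> real \<Rightarrow> (real^'n \<Rightarrow> real^'n) \<Rightarrow> real^'n \<Rightarrow> real^'n" where
  "fxts_gf c1 c2 p1 p2 g x =
    (if g x \<noteq> 0
     then - (c1 *\<^sub>R (g x /\<^sub>R (norm (g x) powr ((p1 - 2) / (p1 - 1)))))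
          - c2 *\<^sub>R (g x /\<^sub>R (norm (g x) powr ((p2 - 2) / (p2 - 1))))
     else 0)"

text \<open>Classical solution on \<open>[0,\<infinity>)\<close>; the derivative at \<open>0\<close> is one-sided.\<close>

definition flow_solution ::
  "(real^'n \<Rightarrow> real^'n) \<Rightarrow> real^'n \<Rightarrow> (real \<Rightarrow> real^'n) \<Rightarrow> bool" where
  "flow_solution F x0 x \<longleftrightarrow>
    x 0 = x0 \<and> (\<forall>t\<ge>0. (x has_vector_derivative F (x t)) (at t within {0..}))"

definition static_regret ::
  "(real^'n \<Rightarrow> real) \<Rightarrow> real^'n \<Rightarrow> (real \<Rightarrow> real^'n) \<Rightarrow> real \<Rightarrow> real" where
  "static_regret f xstar x T = integral {0..T} (\<lambda>t. f (x t) - f xstar)"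

text \<open>
  The closed form of the second summand of the regret bound is \<open>0/0\<close> for \<open>\<beta> = 2\<close>; there its
  limit for \<open>\<beta> \<rightarrow> 2\<close> is used, see \<open>regret_l2_tendsto\<close>.  For \<open>V = 0\<close> the closed form is also
  degenerate and evaluates to \<open>0\<close>, which is its limit for \<open>V \<rightarrow> 0\<close> (with \<open>\<beta> > 1\<close>).
\<close>

definition regret_l2 :: "real \<Rightarrow> real \<Rightarrow> real \<Rightarrow> real" where
  "regret_l2 q \<beta> V =
    (if \<beta> = 2 then ln (1 + V) / q
     else ((1 + V powr (\<beta> - 1)) powr ((\<beta> - 2) / (\<beta> - 1)) - 1)
          / (q * V powr (\<beta> - 2) * (\<beta> - 2)))"

lemma regret_l2_tendsto:
  assumes "V > 0" "q > 0"
  shows "((\<lambda>\<beta>. regret_l2 q \<beta> V) \<longlongrightarrow> regret_l2 q 2 V) (at 2)"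
proof -
  define h where "h = (\<lambda>b. (1 + V powr (b - 1)) powr ((b - 2) / (b - 1)))"
  have pos: "1 + V powr c > 0" for c
    by (smt (verit) powr_ge_zero)
  have h_exp: "h = (\<lambda>b. exp ((b - 2) / (b - 1) * ln (1 + V powr (b - 1))))"
    unfolding h_def using pos by (intro ext) (metis powr_def less_irrefl)
  have nz: "1 + (V * V + V * 2) \<noteq> 0"
    using mult_pos_pos[OF assms(1) assms(1)] assms(1) by linarith
  have "(h has_real_derivative ln (1 + V)) (at 2)"
    unfolding h_exp using assms
    by (auto intro!: derivative_eq_intros pos simp: field_simps)
       (simp add: nonzero_divide_eq_eq[OF nz] algebra_simps)
  then have "((\<lambda>b. (h b - h 2) / (b - 2)) \<longlongrightarrow> ln (1 + V)) (at 2)"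
    by (simp add: has_field_derivative_iff)
  moreover have "h 2 = 1"
    using assms by (simp add: h_def)
  moreover have "((\<lambda>b. q * V powr (b - 2)) \<longlongrightarrow> q * V powr (2 - 2)) (at 2)"
    using assms by (intro tendsto_intros) auto
  ultimately have "((\<lambda>b. (h b - 1) / (b - 2)) \<longlongrightarrow> ln (1 + V)) (at 2)"
    and "((\<lambda>b. q * V powr (b - 2)) \<longlongrightarrow> q) (at 2)"
    using assms by simp_all
  then have "((\<lambda>b. (h b - 1) / (b - 2) / (q * V powr (b - 2))) \<longlongrightarrow> ln (1 + V) / q) (at 2)"
    using assms by (intro tendsto_divide) simp_all
  moreover have "\<forall>\<^sub>F b in at 2. (h b - 1) / (b - 2) / (q * V powr (b - 2)) = regret_l2 q b V"
    unfolding eventually_at_filter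
    by (intro always_eventually allI impI) (simp add: regret_l2_def h_def mult.commute)
  ultimately have "((\<lambda>b. regret_l2 q b V) \<longlongrightarrow> ln (1 + V) / q) (at 2)"
    by (rule Lim_transform_eventually)
  then show ?thesis
    by (simp add: regret_l2_def[of q 2])
qed

end

theory Submission
  imports Defs
begin

text \<open>
  Along the flow the energy \<open>V = f (x t) - f xstar\<close> satisfies
  \<open>V' \<le> - (p * V powr \<alpha> + q * V powr \<beta>)\<close>, and substituting \<open>v = V t\<close> bounds the regret by
  \<open>\<integral> v / (p * v powr \<alpha> + q * v powr \<beta>) dv\<close> over \<open>[0, V 0]\<close>. Below a suitable level \<open>w \<le> 1\<close>
  the integrand is at most \<open>v powr (1 - \<alpha>) / p\<close>, which contributes at most \<open>l1\<close>; above \<open>w\<close> it is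
  at most \<open>v powr (1 - \<beta>) / q\<close>, whose integral over \<open>[w, V 0]\<close> is exactly \<open>l2\<close>.
\<close>

text \<open>
  This is \<open>v / (p * v powr \<alpha> + q * v powr \<beta>)\<close> with \<open>v powr \<alpha>\<close> cancelled, so that it is
  continuous at \<open>0\<close>.
\<close>

definition regret_rate :: "real \<Rightarrow> real \<Rightarrow> real \<Rightarrow> real \<Rightarrow> real \<Rightarrow> real" where
  "regret_rate p q \<alpha> \<beta> v = v powr (1 - \<alpha>) / (p + q * v powr (\<beta> - \<alpha>))"

section \<open>Pointwise bounds for the integrand\<close>

lemma regret_rate_denominator_pos:
  assumes "p > 0" "q > 0"
  shows "p + q * v powr c > (0::real)"
  using assms by (simp add: add_pos_nonneg)

lemma regret_rate_nonneg:
  assumes "p > 0" "q > 0"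
  shows "regret_rate p q \<alpha> \<beta> v \<ge> 0"
  using regret_rate_denominator_pos[OF assms, of v "\<beta> - \<alpha>"]
  by (simp add: regret_rate_def)

lemma continuous_on_regret_rate:
  assumes "p > 0" "q > 0" "\<alpha> < 1" "\<alpha> < \<beta>"
  shows "continuous_on {0..b} (regret_rate p q \<alpha> \<beta>)"
proof -
  have "p + q * v powr (\<beta> - \<alpha>) \<noteq> 0" for v
    using regret_rate_denominator_pos[OF assms(1,2), of v "\<beta> - \<alpha>"] by linarith
  then show ?thesis
    unfolding regret_rate_def[abs_def] using assms
    by (intro continuous_intros continuous_on_powr') auto
qed

text \<open>In product form the relation also covers \<open>v = 0\<close>, a value the energy may
  reach in finite time. It converts the decay inequality into a bound on the energy itself.\<close>

lemma regret_rate_mult: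
  assumes "p > 0" "q > 0" "v \<ge> 0"
  shows "regret_rate p q \<alpha> \<beta> v * (p * v powr \<alpha> + q * v powr \<beta>) = v"
proof (cases "v = 0")
  case False
  then have v: "v > 0" using assms by simp
  have "v powr \<beta> = v powr \<alpha> * v powr (\<beta> - \<alpha>)"
    by (simp flip: powr_add)
  then have "p * v powr \<alpha> + q * v powr \<beta> = v powr \<alpha> * (p + q * v powr (\<beta> - \<alpha>))"
    by (simp add: algebra_simps)
  moreover have "v powr (1 - \<alpha>) * v powr \<alpha> = v"
    using v by (simp flip: powr_add)
  ultimately show ?thesis
    using regret_rate_denominator_pos[OF assms(1,2), of v "\<beta> - \<alpha>"]
    by (simp add: regret_rate_def)
qed (simp add: regret_rate_def)

lemma regret_rate_le_low:
  assumes "p > 0" "q > 0"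
  shows "regret_rate p q \<alpha> \<beta> v \<le> v powr (1 - \<alpha>) / p"
  unfolding regret_rate_def using assms
  by (intro divide_left_mono) (auto intro!: mult_pos_pos add_pos_nonneg)

text \<open>Dropping \<open>p\<close> from the denominator leaves a pure power, but one that is not
  integrable at 0 when \<beta> \<ge> 2; hence its use only away from 0.\<close>

lemma regret_rate_le_high:
  assumes "p > 0" "q > 0" "v > 0"
  shows "regret_rate p q \<alpha> \<beta> v \<le> v powr (1 - \<beta>) / q"
proof -
  have "v powr (1 - \<alpha>) / (p + q * v powr (\<beta> - \<alpha>)) \<le> v powr (1 - \<alpha>) / (q * v powr (\<beta> - \<alpha>))"
    using assms by (intro divide_left_mono) (auto intro!: mult_pos_pos add_pos_nonneg)
  also have "\<dots> = v powr (1 - \<alpha> - (\<beta> - \<alpha>)) / q"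
    using assms by (simp add: powr_diff)
  finally show ?thesis by (simp add: regret_rate_def)
qed

section \<open>The integral of the rate over the energy range\<close>

lemma mult_powr_inverse_le:
  fixes V b :: real
  assumes "V \<ge> 0" "b > 0"
  shows "V * (1 + V powr b) powr (- 1 / b) \<le> V"
proof -
  have "(1 + V powr b) powr (- 1 / b) \<le> (1 + V powr b) powr 0"
    using assms by (intro powr_mono) (auto simp: field_simps)
  \<comment> \<open>Since \<open>0 powr 0 = 0\<close>, the base has to be seen to be
    nonzero.\<close>
  moreover have "(1 + V powr b) powr 0 = 1"
    using powr_ge_zero[of V b] by (simp del: powr_ge_zero)
  ultimately show ?thesis
    using assms(1) mult_left_mono[of _ 1 V] by simp
qed

text \<open>
  \<open>w\<close> is the value at time \<open>1 / (q * (\<beta> - 1))\<close> of the solution of \<open>v' = - q * v powr \<beta>\<close>,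
  \<open>v 0 = V\<close>; this is the time within which any such solution falls below \<open>1\<close>.
\<close>

lemma has_integral_powr_high:
  fixes w V \<beta> q :: real
  assumes q: "q > 0" and V: "V > 0" and \<beta>: "\<beta> > 1"
    and w: "w = V * (1 + V powr (\<beta> - 1)) powr (- 1 / (\<beta> - 1))"
  shows "((\<lambda>v. v powr (1 - \<beta>) / q) has_integral regret_l2 q \<beta> V) {w..V}"
proof -
  define s where "s = 1 + V powr (\<beta> - 1)"
  have s: "s \<ge> 1" by (simp add: s_def)
  have w': "w = V * s powr (- 1 / (\<beta> - 1))" by (simp add: w s_def)
  have wV: "w \<le> V"
    using V \<beta> unfolding w by (intro mult_powr_inverse_le) auto
  have w0: "w > 0" using V s by (simp add: w')
  show ?thesis
  proof (cases "\<beta> = 2")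
    case True
    have "((\<lambda>v. v powr (1 - \<beta>) / q) has_integral ln V / q - ln w / q) {w..V}"
      using wV w0 q True
      by (intro fundamental_theorem_of_calculus)
         (auto intro!: derivative_eq_intros
           simp: has_real_derivative_iff_has_vector_derivative[symmetric] powr_minus field_simps)
    moreover have "ln V / q - ln w / q = regret_l2 q \<beta> V"
    proof -
      have "ln w = ln V - ln (1 + V)"
        using V True by (simp add: w ln_div powr_minus_divide)
      then show ?thesis
        using True by (simp add: regret_l2_def flip: diff_divide_distrib)
    qed
    ultimately show ?thesis by simp
  next
    case False
    have "((\<lambda>v. v powr (1 - \<beta>) / q) has_integral
            V powr (2 - \<beta>) / (q * (2 - \<beta>)) - w powr (2 - \<beta>) / (q * (2 - \<beta>))) {w..V}"
      using wV w0 q False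
      by (intro fundamental_theorem_of_calculus)
         (auto intro!: derivative_eq_intros
           simp: has_real_derivative_iff_has_vector_derivative[symmetric])
    moreover have "w powr (2 - \<beta>) = V powr (2 - \<beta>) * s powr ((\<beta> - 2) / (\<beta> - 1))"
    proof -
      have e: "- 1 / (\<beta> - 1) * (2 - \<beta>) = (\<beta> - 2) / (\<beta> - 1)"
        using \<beta> by (simp add: divide_simps)
      have "w powr (2 - \<beta>) = V powr (2 - \<beta>) * (s powr (- 1 / (\<beta> - 1))) powr (2 - \<beta>)"
        unfolding w' by (rule powr_mult)
      then show ?thesis by (simp only: powr_powr e)
    qed
    moreover have "V powr (2 - \<beta>) = 1 / V powr (\<beta> - 2)"
      by (metis minus_diff_eq powr_minus_divide)
    \<comment> \<open>To be read with \<open>X = V powr (\<beta> - 2)\<close> and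
      \<open>Y = s powr ((\<beta> - 2) / (\<beta> - 1))\<close>. For \<open>X = 0\<close> both sides
      are 0, because division by 0 gives 0.\<close>
    moreover have "1 / X / (q * (2 - \<beta>)) - 1 / X * Y / (q * (2 - \<beta>)) = (Y - 1) / (q * X * (\<beta> - 2))"
      for X Y
    proof -
      have neg: "q * (2 - \<beta>) = - (q * (\<beta> - 2))" by (simp add: algebra_simps)
      show ?thesis
        unfolding neg using False q by (cases "X = 0") (simp_all add: divide_simps)
    qed
    ultimately show ?thesis
      unfolding regret_l2_def s_def[symmetric] if_not_P[OF False] by (simp only:)
  qed
qed

lemma integral_regret_rate_le:
  assumes p: "p > 0" and q: "q > 0" and \<alpha>: "\<alpha> < 1" and \<beta>: "\<beta> > 1" and V: "V \<ge> 0"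
  shows "integral {0..V} (regret_rate p q \<alpha> \<beta>) \<le> 1 / (p * (2 - \<alpha>)) + regret_l2 q \<beta> V"
proof (cases "V = 0")
  \<comment> \<open>The interval is a single point, and \<open>regret_l2\<close> is 0 there because
    its numerator vanishes.\<close>
  case True
  then show ?thesis using p \<alpha> by (simp add: regret_l2_def)
next
  case False
  then have V0: "V > 0" using V by simp
  define s where "s = 1 + V powr (\<beta> - 1)"
  define w where "w = V * s powr (- 1 / (\<beta> - 1))"
  have s: "s > 1" using V0 by (simp add: s_def)
  have w0: "w > 0" using V0 s by (simp add: w_def)
  have wV: "w \<le> V"
    using V \<beta> unfolding w_def s_def by (intro mult_powr_inverse_le) auto
  \<comment> \<open>\<open>V powr (\<beta> - 1)\<close> is a summand of \<open>s\<close>, so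
    \<open>V\<close> is at most the reciprocal of the other factor of \<open>w\<close>.\<close>
  have w1: "w \<le> 1"
  proof -
    have "(V powr (\<beta> - 1)) powr (1 / (\<beta> - 1)) \<le> s powr (1 / (\<beta> - 1))"
      using \<beta> by (intro powr_mono2) (auto simp: s_def)
    then have "V \<le> s powr (1 / (\<beta> - 1))"
      using V0 \<beta> by (simp add: powr_powr)
    then show ?thesis
      using s by (simp add: w_def powr_minus_divide minus_divide_left[symmetric])
  qed
  have int: "regret_rate p q \<alpha> \<beta> integrable_on {a..b}" if "a \<ge> 0" for a b
    using continuous_on_regret_rate[OF p q, of \<alpha> \<beta> b] \<alpha> \<beta> that
    by (intro integrable_continuous_interval) (auto elim: continuous_on_subset)
  have low_int: "((\<lambda>v. v powr (1 - \<alpha>) / p) has_integral w powr (2 - \<alpha>) / (2 - \<alpha>) / p) {0..w}"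
    using has_integral_divide[OF has_integral_powr_from_0[of "1 - \<alpha>" w], of p] \<alpha> w0 by simp
  have "integral {0..w} (regret_rate p q \<alpha> \<beta>) \<le> w powr (2 - \<alpha>) / (2 - \<alpha>) / p"
    using regret_rate_le_low[OF p q]
    by (intro has_integral_le[OF integrable_integral[OF int] low_int]) auto
  also have "\<dots> \<le> 1 / (p * (2 - \<alpha>))"
  proof -
    have "w powr (2 - \<alpha>) \<le> 1" using w0 w1 \<alpha> by (intro powr_le1) auto
    then have "w powr (2 - \<alpha>) / (2 - \<alpha>) / p \<le> 1 / (2 - \<alpha>) / p"
      using p \<alpha> by (intro divide_right_mono) auto
    then show ?thesis by (simp add: mult.commute)
  qed
  finally have low: "integral {0..w} (regret_rate p q \<alpha> \<beta>) \<le> 1 / (p * (2 - \<alpha>))" .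
  have high: "integral {w..V} (regret_rate p q \<alpha> \<beta>) \<le> regret_l2 q \<beta> V"
    using w0
    by (intro has_integral_le[OF integrable_integral[OF int]
          has_integral_powr_high[OF q V0 \<beta> w_def[unfolded s_def]]] regret_rate_le_high p q) auto
  have "integral {0..V} (regret_rate p q \<alpha> \<beta>) =
      integral {0..w} (regret_rate p q \<alpha> \<beta>) + integral {w..V} (regret_rate p q \<alpha> \<beta>)"
    using w0 wV int by (intro Henstock_Kurzweil_Integration.integral_combine[symmetric]) auto
  with low high show ?thesis by linarith
qed

section \<open>From time to energy\<close>

text \<open>For an antiderivative \<open>\<Phi>\<close> of the rate, \<open>\<Phi> (V t)\<close>
  decreases at least as fast as \<open>V t\<close> accumulates, so the regret is at most the total
  drop of \<open>\<Phi>\<close>. Neither an inverse of \<open>V\<close> nor a comparison solution is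
  needed.\<close>

lemma integral_le_integral_regret_rate:
  fixes V V' :: "real \<Rightarrow> real"
  assumes p: "p > 0" and q: "q > 0" and \<alpha>: "\<alpha> < 1" and \<alpha>\<beta>: "\<alpha> < \<beta>" and T: "T \<ge> 0"
    and deriv: "\<And>t. t \<in> {0..T} \<Longrightarrow> (V has_real_derivative V' t) (at t within {0..T})"
    and nonneg: "\<And>t. t \<in> {0..T} \<Longrightarrow> V t \<ge> 0"
    and decay: "\<And>t. t \<in> {0..T} \<Longrightarrow> V' t \<le> - (p * V t powr \<alpha> + q * V t powr \<beta>)"
  shows "integral {0..T} V \<le> integral {0..V 0} (regret_rate p q \<alpha> \<beta>)"
proof -
  let ?r = "regret_rate p q \<alpha> \<beta>"
  define \<Phi> where "\<Phi> v = integral {0..v} ?r" for v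
  have contV: "continuous_on {0..T} V"
    using deriv DERIV_continuous_on by blast
  have V'_nonpos: "V' t \<le> 0" if "t \<in> {0..T}" for t
    using decay[OF that] p q by (smt (verit) mult_nonneg_nonneg powr_ge_zero)
  \<comment> \<open>Keeps \<open>V t\<close> in the interval on which \<open>\<Phi>\<close> is
    differentiated.\<close>
  have V_le: "V t \<le> V 0" if t: "t \<in> {0..T}" for t
  proof (cases "t = 0")
    case False
    show ?thesis
    proof (rule DERIV_nonpos_imp_decreasing_open[of 0 t V])
      show "continuous_on {0..t} V"
        using contV t by (auto elim: continuous_on_subset)
      show "\<exists>y. DERIV V s :> y \<and> y \<le> 0" if "0 < s" "s < t" for s
        using deriv[of s] V'_nonpos[of s] that t at_within_Icc_at[of 0 s T] by auto
    qed (use t in auto)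
  qed simp
  have \<Phi>_deriv: "(\<Phi> has_real_derivative ?r v) (at v within {0..V 0})" if "v \<in> {0..V 0}" for v
    unfolding \<Phi>_def has_real_derivative_iff_has_vector_derivative
    using continuous_on_regret_rate[OF p q \<alpha> \<alpha>\<beta>] that by (intro integral_has_vector_derivative)
  have "((\<lambda>t. \<Phi> (V t)) has_real_derivative ?r (V t) * V' t) (at t within {0..T})"
    if t: "t \<in> {0..T}" for t
  proof -
    \<comment> \<open>The derivative of \<open>\<Phi>\<close> is one-sided at the ends of
      \<open>{0..V 0}\<close>, so the chain rule is applied within the image of
      \<open>V\<close>.\<close>
    have "V ` {0..T} \<subseteq> {0..V 0}" using V_le nonneg by auto
    then have "(\<Phi> has_real_derivative ?r (V t)) (at (V t) within V ` {0..T})"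
      using \<Phi>_deriv[of "V t"] t V_le nonneg by (auto intro: DERIV_subset)
    from DERIV_image_chain[OF this deriv[OF t]] show ?thesis by (simp add: o_def)
  qed
  then have "((\<lambda>t. ?r (V t) * V' t) has_integral \<Phi> (V T) - \<Phi> (V 0)) {0..T}"
    using T by (intro fundamental_theorem_of_calculus)
      (auto simp: has_real_derivative_iff_has_vector_derivative)
  from has_integral_neg[OF this]
  have "((\<lambda>t. - (?r (V t) * V' t)) has_integral \<Phi> (V 0) - \<Phi> (V T)) {0..T}"
    by simp
  then have "integral {0..T} V \<le> \<Phi> (V 0) - \<Phi> (V T)"
  proof (rule has_integral_le[OF integrable_integral[OF integrable_continuous_interval[OF contV]]])
    fix t assume t: "t \<in> {0..T}"
    have "V t = ?r (V t) * (p * V t powr \<alpha> + q * V t powr \<beta>)"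
      using regret_rate_mult[OF p q nonneg[OF t]] by simp
    also have "\<dots> \<le> ?r (V t) * (- V' t)"
      using decay[OF t] by (intro mult_left_mono regret_rate_nonneg p q) linarith
    finally show "V t \<le> - (?r (V t) * V' t)" by simp
  qed
  moreover have "\<Phi> (V T) \<ge> 0"
    unfolding \<Phi>_def using regret_rate_nonneg[OF p q] continuous_on_regret_rate[OF p q \<alpha> \<alpha>\<beta>]
    by (intro integral_nonneg integrable_continuous_interval) auto
  ultimately show ?thesis by (simp add: \<Phi>_def)
qed

section \<open>Energy decay along the flow\<close>

text \<open>The inner product equals \<open>c * norm g powr (2 * a)\<close>, and gradient dominance
  raised to the power \<open>a\<close> bounds this from below.\<close>

lemma gradient_dominated_powr:
  fixes g :: "'a::real_inner"
  assumes g: "g \<noteq> 0" and V: "V \<ge> 0" and \<mu>: "\<mu> > 0" and c: "c > 0"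
    and dom: "1/2 * (norm g)\<^sup>2 \<ge> \<mu> * V" and a: "a > 0"
  shows "c * (2 * \<mu>) powr a * V powr a \<le> (c *\<^sub>R (g /\<^sub>R (norm g powr (2 - 2 * a)))) \<bullet> g"
proof -
  have N: "norm g > 0" using g by simp
  have "(2 * \<mu>) powr a * V powr a = (2 * \<mu> * V) powr a"
    using \<mu> V by (simp add: powr_mult)
  also have "\<dots> \<le> ((norm g)\<^sup>2) powr a"
    using dom \<mu> V a by (intro powr_mono2) auto
  also have "\<dots> = norm g powr (2 - (2 - 2 * a))"
    using N by (simp add: powr_powr flip: powr_numeral)
  also have "\<dots> = (norm g)\<^sup>2 / norm g powr (2 - 2 * a)"
    using N by (simp only: powr_diff powr_numeral)
  finally have "c * ((2 * \<mu>) powr a * V powr a) \<le> c * ((norm g)\<^sup>2 / norm g powr (2 - 2 * a))"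
    using c by (intro mult_left_mono) auto
  then show ?thesis
    by (simp add: divide_inverse mult_ac power2_norm_eq_inner)
qed

lemma fxts_gf_energy_decay:
  assumes "1 < p1" "1 < p2" "c1 > 0" "c2 > 0" "\<mu> > 0" "V \<ge> 0"
    and dom: "1/2 * (norm (g y))\<^sup>2 \<ge> \<mu> * V"
    and \<alpha>: "\<alpha> = p1 / (2 * (p1 - 1))" and \<beta>: "\<beta> = p2 / (2 * (p2 - 1))"
  shows "fxts_gf c1 c2 p1 p2 g y \<bullet> g y
    \<le> - (c1 * (2 * \<mu>) powr \<alpha> * V powr \<alpha> + c2 * (2 * \<mu>) powr \<beta> * V powr \<beta>)"
proof (cases "g y = 0")
  case True
  \<comment> \<open>At a critical point gradient dominance leaves no excess energy, so both sides of
    the claim are 0.\<close>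
  then have "V = 0"
    using dom \<open>\<mu> > 0\<close> \<open>V \<ge> 0\<close> by (simp add: mult_le_0_iff)
  then show ?thesis using True by (simp add: fxts_gf_def)
next
  case False
  \<comment> \<open>This is where \<alpha> and \<beta> come from: each is half the power of the
    gradient norm that its term of the flow dissipates.\<close>
  have ex: "(p1 - 2) / (p1 - 1) = 2 - 2 * \<alpha>" "(p2 - 2) / (p2 - 1) = 2 - 2 * \<beta>"
    using assms(1,2) by (simp_all add: \<alpha> \<beta> field_simps)
  have "\<alpha> > 0" "\<beta> > 0" using assms(1,2) by (simp_all add: \<alpha> \<beta>)
  then show ?thesis
    using gradient_dominated_powr[OF False \<open>V \<ge> 0\<close> \<open>\<mu> > 0\<close> \<open>c1 > 0\<close> dom, of \<alpha>]
      gradient_dominated_powr[OF False \<open>V \<ge> 0\<close> \<open>\<mu> > 0\<close> \<open>c2 > 0\<close> dom, of \<beta>] False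
    unfolding fxts_gf_def ex by (simp add: inner_diff_left)
qed

theorem theorem3:
  fixes f :: "real^'n \<Rightarrow> real" and grad :: "real^'n \<Rightarrow> real^'n"
    and xstar x0 :: "real^'n" and x :: "real \<Rightarrow> real^'n"
    and \<mu> c1 c2 p1 p2 \<alpha> \<beta> p q V0 l1 l2 T :: real
  assumes gradient: "\<forall>y. GDERIV f y :> grad y"
    and gradient_continuous: "continuous_on UNIV grad"
    and gradient_locally_lipschitz: "\<forall>y. \<exists>u>0. \<exists>L. L-lipschitz_on (cball y u) grad"
    and minimizer: "\<forall>y. f xstar \<le> f y"
    and minimizer_unique: "\<forall>z. (\<forall>y. f z \<le> f y) \<longrightarrow> z = xstar"
    and mu_pos: "\<mu> > 0"
    and gradient_dominated: "\<forall>y. 1/2 * (norm (grad y))\<^sup>2 \<ge> \<mu> * (f y - f xstar)"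
    and c1_pos: "c1 > 0" and c2_pos: "c2 > 0"
    and p1_gt: "p1 > 2" and p2_gt: "1 < p2" and p2_less: "p2 < 2"
    and alpha: "\<alpha> = p1 / (2 * (p1 - 1))"
    and beta: "\<beta> = p2 / (2 * (p2 - 1))"
    and p: "p = c1 * (2 * \<mu>) powr \<alpha>"
    and q: "q = c2 * (2 * \<mu>) powr \<beta>"
    and flow: "flow_solution (fxts_gf c1 c2 p1 p2 grad) x0 x"
    and T_pos: "T > 0"
    and V0: "V0 = f x0 - f xstar"
    and l1: "l1 = 1 / (p * (2 - \<alpha>))"
    and l2: "l2 = regret_l2 q \<beta> V0"
  shows "static_regret f xstar x T \<le> l1 + l2"
proof -
  let ?V = "\<lambda>t. f (x t) - f xstar"
  let ?F = "fxts_gf c1 c2 p1 p2 grad"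
  have pq: "p > 0" "q > 0" using c1_pos c2_pos mu_pos by (simp_all add: p q)
  \<comment> \<open>\<alpha> < 1 amounts to \<open>p1 > 2\<close>, and \<beta> > 1 to
    \<open>p2 < 2\<close>.\<close>
  have \<alpha>1: "\<alpha> < 1" and \<beta>1: "\<beta> > 1"
    using p1_gt p2_gt p2_less by (simp_all add: alpha beta field_simps)
  have x0: "x 0 = x0" using flow by (simp add: flow_solution_def)
  have deriv: "(?V has_real_derivative ?F (x t) \<bullet> grad (x t)) (at t within {0..T})"
    if "t \<in> {0..T}" for t
  proof -
    have "(x has_derivative (\<lambda>h. h *\<^sub>R ?F (x t))) (at t within {0..T})"
      using flow that unfolding flow_solution_def has_vector_derivative_def
      by (auto intro: has_derivative_subset)
    moreover have "(f has_derivative (\<lambda>h. h \<bullet> grad (x t))) (at (x t))"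
      using gradient by (simp add: gderiv_def)
    ultimately have "((\<lambda>t. f (x t)) has_derivative (\<lambda>h. (h *\<^sub>R ?F (x t)) \<bullet> grad (x t)))
        (at t within {0..T})"
      by (rule has_derivative_compose)
    then have "((\<lambda>t. f (x t)) has_real_derivative ?F (x t) \<bullet> grad (x t)) (at t within {0..T})"
      by (simp add: has_field_derivative_def mult_commute_abs)
    from DERIV_diff[OF this DERIV_const[of "f xstar"]] show ?thesis by simp
  qed
  have nonneg: "?V t \<ge> 0" for t using minimizer by simp
  have decay: "?F (x t) \<bullet> grad (x t) \<le> - (p * ?V t powr \<alpha> + q * ?V t powr \<beta>)" for t
    unfolding p q using p1_gt p2_gt c1_pos c2_pos mu_pos nonneg gradient_dominated
    by (intro fxts_gf_energy_decay alpha beta) auto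
  have "integral {0..T} ?V \<le> integral {0..?V 0} (regret_rate p q \<alpha> \<beta>)"
    using \<alpha>1 \<beta>1 T_pos deriv nonneg decay by (intro integral_le_integral_regret_rate pq) auto
  also have "\<dots> \<le> l1 + l2"
    unfolding l1 l2 V0 x0[symmetric]
    by (intro integral_regret_rate_le pq \<alpha>1 \<beta>1 nonneg)
  finally show ?thesis by (simp add: static_regret_def)
qed

end
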